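(* Let $G$ be a just infinite group that is not virtually abelian. Let $H$ be a non-trivial normal subgroup of $G$. The following are equivalent: (i) $H$ is just infinite; (ii) every maximal subgroup of $G$ containing $H$ is just infinite. In particular, $G$ is hereditarily just infinite if and only if every maximal subgroup of $G$ of finite index is just infinite.
   Context: All groups are topological groups; subgroups are required to be closed, homomorphisms are continuous, and generation means topological generation (a discrete group is the special case in which these conventions are vacuous). A group $G$ is residually finite if the intersection of all its normal subgroups of finite index is trivial. $G$ is just infinite if it is infinite, residually finite, and every non-trivial normal subgroup of $G$ has finite index. $G$ is hereditarily just infinite if every finite index subgroup of $G$, including $G$ itself, is just infinite. A maximal subgroup of $G$ is a proper subgroup not properly contained in any other proper subgroup. *)

theory Defs
  imports "HOL-Algebra.Coset" "HOL-Analysis.Product_Topology"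
begin

locale topological_group = group G for G :: "('a, 'b) monoid_scheme" (structure) +
  fixes T :: "'a topology"
  assumes topspace_eq_carrier: "topspace T = carrier G"
    and continuous_mult: "continuous_map (prod_topology T T) T (\<lambda>(x, y). x \<otimes> y)"
    and continuous_inv: "continuous_map T T (\<lambda>x. inv x)"

text \<open>
  A group with its topology is a pair of arguments \<open>G\<close>, \<open>T\<close>. A subgroup \<open>H\<close> is itself regarded as
  the topological group \<open>G\<lparr>carrier := H\<rparr>\<close> with topology \<open>subtopology T H\<close>. Subgroups are closed
  throughout; a discrete group is the case \<open>T = discrete_topology (carrier G)\<close>.
\<close>

definition closed_subgroup :: "'a set \<Rightarrow> ('a, 'b) monoid_scheme \<Rightarrow> 'a topology \<Rightarrow> bool" where
  "closed_subgroup H G T \<longleftrightarrow> subgroup H G \<and> closedin T H"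

definition closed_normal :: "'a set \<Rightarrow> ('a, 'b) monoid_scheme \<Rightarrow> 'a topology \<Rightarrow> bool" where
  "closed_normal N G T \<longleftrightarrow> N \<lhd> G \<and> closedin T N"

definition finite_index :: "'a set \<Rightarrow> ('a, 'b) monoid_scheme \<Rightarrow> bool" where
  "finite_index H G \<longleftrightarrow> finite (rcosets\<^bsub>G\<^esub> H)"

definition residually_finite :: "('a, 'b) monoid_scheme \<Rightarrow> 'a topology \<Rightarrow> bool" where
  "residually_finite G T \<longleftrightarrow> \<Inter> {N. closed_normal N G T \<and> finite_index N G} = {\<one>\<^bsub>G\<^esub>}"

definition just_infinite :: "('a, 'b) monoid_scheme \<Rightarrow> 'a topology \<Rightarrow> bool" where
  "just_infinite G T \<longleftrightarrow>
     infinite (carrier G) \<and> residually_finite G T \<and>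
     (\<forall>N. closed_normal N G T \<and> N \<noteq> {\<one>\<^bsub>G\<^esub>} \<longrightarrow> finite_index N G)"

abbreviation just_infinite_subgroup :: "'a set \<Rightarrow> ('a, 'b) monoid_scheme \<Rightarrow> 'a topology \<Rightarrow> bool" where
  "just_infinite_subgroup H G T \<equiv> just_infinite (G\<lparr>carrier := H\<rparr>) (subtopology T H)"

definition hereditarily_just_infinite :: "('a, 'b) monoid_scheme \<Rightarrow> 'a topology \<Rightarrow> bool" where
  "hereditarily_just_infinite G T \<longleftrightarrow>
     (\<forall>H. closed_subgroup H G T \<and> finite_index H G \<longrightarrow> just_infinite_subgroup H G T)"

definition virtually_abelian :: "('a, 'b) monoid_scheme \<Rightarrow> 'a topology \<Rightarrow> bool" where
  "virtually_abelian G T \<longleftrightarrow>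
     (\<exists>A. closed_subgroup A G T \<and> finite_index A G \<and> comm_group (G\<lparr>carrier := A\<rparr>))"

text \<open>Maximality is among proper closed subgroups.\<close>

definition maximal_subgroup :: "'a set \<Rightarrow> ('a, 'b) monoid_scheme \<Rightarrow> 'a topology \<Rightarrow> bool" where
  "maximal_subgroup M G T \<longleftrightarrow>
     closed_subgroup M G T \<and> M \<noteq> carrier G \<and>
     (\<forall>K. closed_subgroup K G T \<and> K \<noteq> carrier G \<longrightarrow> \<not> M \<subset> K)"

end

theory Submission
  imports Defs
begin

text \<open>
  In a just infinite group \<open>G\<close> that is not virtually abelian, no non-trivial element centralizes a
  closed subgroup of finite index: otherwise the core \<open>R\<close> of that subgroup has a non-trivial, hence
  finite index, centralizer, and \<open>R \<inter> C\<^sub>G(R)\<close> is abelian of finite index.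

  If \<open>H\<close> is just infinite and \<open>K\<close> is a non-trivial closed normal subgroup of \<open>M \<ge> H\<close>, then \<open>K\<close> meets
  \<open>H\<close> in a subgroup of finite index, since otherwise \<open>K \<inter> H\<close> is trivial and \<open>K\<close> centralizes \<open>H\<close>.

  Conversely let \<open>K\<close> be a non-trivial closed normal subgroup of \<open>H\<close>, and \<open>L\<close> a minimal non-trivial
  intersection of \<open>G\<close>-conjugates of \<open>K\<close>, chosen inside \<open>K\<close>. Distinct conjugates of \<open>L\<close> intersect
  trivially and hence commute. If \<open>L\<close> is normal in \<open>G\<close>, it has finite index. Otherwise its normalizer
  lies in some maximal \<open>M\<close>. Let \<open>Q\<close> be the centralizer in \<open>M\<close> of all conjugates \<open>L\<^sup>g\<close> with \<open>g \<notin> M\<close>. It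
  is normal in \<open>M\<close> and contains \<open>L\<close>, so it has finite index when \<open>M\<close> is just infinite; but it is
  centralized by the non-trivial \<open>L\<^sup>g\<close>, a contradiction.
\<close>

section \<open>Finite index, conjugates and normality in subgroups\<close>

context group
begin

lemma l_inv_assoc: "g \<in> carrier G \<Longrightarrow> x \<in> carrier G \<Longrightarrow> inv g \<otimes> (g \<otimes> x) = x"
  by (simp add: m_assoc[symmetric])

section \<open>Finite index via transversals\<close>

text \<open>\<open>x \<otimes> inv t \<in> H\<close> says that \<open>x\<close> and \<open>t\<close>
  lie in the same right coset. Representatives, unlike cosets, can be multiplied and translated,
  which is how index in a tower and index of a conjugate are handled below. Redundant
  representatives are allowed.\<close>

lemma finite_index_iff_transversal:
  assumes H: "subgroup H G"
  shows "finite_index H G \<longleftrightarrow>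
    (\<exists>F. finite F \<and> F \<subseteq> carrier G \<and> (\<forall>x\<in>carrier G. \<exists>t\<in>F. x \<otimes> inv t \<in> H))"
proof
  assume fin: "finite_index H G"
  have "rcosets H \<subseteq> (\<lambda>a. H #> a) ` carrier G"
    by (auto simp: RCOSETS_def)
  then obtain F where F: "F \<subseteq> carrier G" "finite F" "rcosets H = (\<lambda>a. H #> a) ` F"
    using fin finite_subset_image unfolding finite_index_def by metis
  have "\<exists>t\<in>F. x \<otimes> inv t \<in> H" if x: "x \<in> carrier G" for x
  proof -
    have "H #> x \<in> (\<lambda>a. H #> a) ` F"
      using rcosetsI[OF subgroup.subset[OF H] x] F(3) by simp
    then obtain t where t: "t \<in> F" "H #> x = H #> t"
      by auto
    have "x \<in> H #> t"
      using rcos_self[OF x H] t(2) by simp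
    then obtain h where h: "h \<in> H" "x = h \<otimes> t"
      by (auto simp: r_coset_def)
    then have "x \<otimes> inv t = h"
      using t(1) F(1) subgroup.mem_carrier[OF H] by (auto simp: m_assoc)
    with h t show ?thesis by metis
  qed
  with F(1,2) show "\<exists>F. finite F \<and> F \<subseteq> carrier G \<and> (\<forall>x\<in>carrier G. \<exists>t\<in>F. x \<otimes> inv t \<in> H)"
    by blast
next
  assume "\<exists>F. finite F \<and> F \<subseteq> carrier G \<and> (\<forall>x\<in>carrier G. \<exists>t\<in>F. x \<otimes> inv t \<in> H)"
  then obtain F where F: "finite F" "F \<subseteq> carrier G" "\<forall>x\<in>carrier G. \<exists>t\<in>F. x \<otimes> inv t \<in> H"
    by blast
  have "rcosets H \<subseteq> (\<lambda>a. H #> a) ` F"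
  proof
    fix C assume "C \<in> rcosets H"
    then obtain x where x: "x \<in> carrier G" "C = H #> x"
      by (auto simp: RCOSETS_def)
    obtain t where t: "t \<in> F" "x \<otimes> inv t \<in> H"
      using F(3) x by auto
    then have tc: "t \<in> carrier G" using F by auto
    have "x = (x \<otimes> inv t) \<otimes> t"
      using x tc by (simp add: m_assoc)
    then have "x \<in> H #> t"
      using t by (auto simp: r_coset_def)
    then have "H #> t = H #> x"
      using repr_independence[OF _ tc H] by simp
    with t x show "C \<in> (\<lambda>a. H #> a) ` F" by auto
  qed
  then show "finite_index H G"
    unfolding finite_index_def using F(1) finite_surj by blast
qed

lemma finite_index_mono:
  assumes "subgroup H G" "subgroup K G" "H \<subseteq> K" "finite_index H G"
  shows "finite_index K G"
  using assms(3,4) unfolding finite_index_iff_transversal[OF assms(1)] finite_index_iff_transversal[OF assms(2)]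
  by (metis subsetD)

text \<open>A right coset of the intersection is the intersection of the two cosets through the same
  element, so a pair of cosets determines it.\<close>

lemma finite_index_Int:
  assumes H: "subgroup H G" and K: "subgroup K G" and "finite_index H G" "finite_index K G"
  shows "finite_index (H \<inter> K) G"
proof -
  have "rcosets (H \<inter> K) \<subseteq> (\<lambda>(A, B). A \<inter> B) ` ((rcosets H) \<times> (rcosets K))"
  proof
    fix C assume "C \<in> rcosets (H \<inter> K)"
    then obtain x where x: "x \<in> carrier G" "C = (H \<inter> K) #> x"
      by (auto simp: RCOSETS_def)
    have "C = (H #> x) \<inter> (K #> x)"
      using x subgroup.mem_carrier[OF H] subgroup.mem_carrier[OF K]
      by (auto simp: r_coset_def)
    then show "C \<in> (\<lambda>(A, B). A \<inter> B) ` ((rcosets H) \<times> (rcosets K))"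
      using rcosetsI[OF subgroup.subset[OF H] x(1)] rcosetsI[OF subgroup.subset[OF K] x(1)] by auto
  qed
  then show ?thesis
    using assms(3,4) unfolding finite_index_def by (meson finite_SigmaI finite_surj)
qed

lemma finite_index_carrier: "finite_index (carrier G) G"
  unfolding finite_index_iff_transversal[OF subgroup_self]
  by (intro exI[of _ "{\<one>}"]) auto

text \<open>Intersecting with \<open>carrier G\<close> gives the empty family its correct value,
  since an empty intersection is \<open>UNIV\<close>.\<close>

lemma finite_index_INT:
  assumes "finite I" "\<And>i. i \<in> I \<Longrightarrow> subgroup (A i) G \<and> finite_index (A i) G"
  shows "subgroup (carrier G \<inter> (\<Inter>i\<in>I. A i)) G \<and> finite_index (carrier G \<inter> (\<Inter>i\<in>I. A i)) G"
  using assms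
proof (induction I rule: finite_induct)
  case empty
  then show ?case by (simp add: subgroup_self finite_index_carrier)
next
  case (insert i I)
  have "carrier G \<inter> (\<Inter>j\<in>insert i I. A j) = A i \<inter> (carrier G \<inter> (\<Inter>j\<in>I. A j))"
    by auto
  with insert show ?case
    by (auto intro: subgroups_Inter_pair finite_index_Int)
qed

text \<open>Products of representatives of \<open>K\<close> in \<open>H\<close> with representatives
  of \<open>H\<close> in \<open>G\<close> represent \<open>K\<close> in \<open>G\<close>.\<close>

lemma finite_index_trans:
  assumes H: "subgroup H G" and K: "subgroup K G" "K \<subseteq> H"
    and "finite_index H G" "finite_index K (G\<lparr>carrier := H\<rparr>)"
  shows "finite_index K G"
proof -
  interpret H: group "G\<lparr>carrier := H\<rparr>"
    using subgroup.subgroup_is_group[OF H is_group] .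
  have KH: "subgroup K (G\<lparr>carrier := H\<rparr>)"
    using subgroup_incl[OF K(1) H K(2)] .
  obtain F where F: "finite F" "F \<subseteq> carrier G" "\<forall>x\<in>carrier G. \<exists>t\<in>F. x \<otimes> inv t \<in> H"
    using assms(4) unfolding finite_index_iff_transversal[OF H] by auto
  obtain E where E: "finite E" "E \<subseteq> H"
    "\<forall>x\<in>H. \<exists>t\<in>E. x \<otimes> inv\<^bsub>G\<lparr>carrier := H\<rparr>\<^esub> t \<in> K"
    using assms(5) unfolding H.finite_index_iff_transversal[OF KH] by auto
  have "\<exists>t\<in>(\<lambda>(s, t). s \<otimes> t) ` (E \<times> F). x \<otimes> inv t \<in> K" if x: "x \<in> carrier G" for x
  proof -
    obtain t where t: "t \<in> F" "x \<otimes> inv t \<in> H" using F x by auto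
    obtain s where s: "s \<in> E" "(x \<otimes> inv t) \<otimes> inv\<^bsub>G\<lparr>carrier := H\<rparr>\<^esub> s \<in> K"
      using E t by auto
    have sc: "s \<in> H" "s \<in> carrier G" "t \<in> carrier G"
      using s t E F subgroup.mem_carrier[OF H] by auto
    have "(x \<otimes> inv t) \<otimes> inv s \<in> K"
      using s(2) m_inv_consistent[OF H sc(1)] by simp
    moreover have "(x \<otimes> inv t) \<otimes> inv s = x \<otimes> inv (s \<otimes> t)"
      using sc x by (simp add: inv_mult_group m_assoc)
    ultimately show ?thesis using s t by auto
  qed
  moreover have "finite ((\<lambda>(s, t). s \<otimes> t) ` (E \<times> F))" using E F by simp
  moreover have "(\<lambda>(s, t). s \<otimes> t) ` (E \<times> F) \<subseteq> carrier G"
    using E(2) F(2) subgroup.subset[OF H] by (auto intro!: m_closed)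
  ultimately show ?thesis
    unfolding finite_index_iff_transversal[OF K(1)] by blast
qed

lemma finite_index_subgroup:
  assumes H: "subgroup H G" and "finite_index K G"
  shows "finite_index K (G\<lparr>carrier := H\<rparr>)"
proof -
  have "rcosets\<^bsub>G\<lparr>carrier := H\<rparr>\<^esub> K \<subseteq> rcosets K"
    using subgroup.subset[OF H] by (auto simp: RCOSETS_def r_coset_def)
  then show ?thesis
    using assms(2) unfolding finite_index_def by (rule finite_subset)
qed

lemma finite_carrier_if_finite_index:
  assumes H: "subgroup H G" and "finite_index H G" "finite H"
  shows "finite (carrier G)"
proof -
  have "finite (\<Union>(rcosets H))"
    using assms unfolding finite_index_def by (auto simp: RCOSETS_def r_coset_def)
  then show ?thesis
    using rcosets_part_G[OF H] by simp
qed

text \<open>This decomposition has two uses when \<open>H\<close> has finite index: there are only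
  finitely many overgroups, and each is closed as soon as \<open>H\<close> is.\<close>

lemma supergroup_eq_Union_rcosets:
  assumes H: "subgroup H G" and K: "subgroup K G" "H \<subseteq> K"
  shows "K = \<Union>((\<lambda>k. H #> k) ` K)" and "(\<lambda>k. H #> k) ` K \<subseteq> rcosets H"
proof -
  have "k \<in> H #> k" if "k \<in> K" for k
    using rcos_self[OF subgroup.mem_carrier[OF K(1) that] H] .
  moreover have "H #> k \<subseteq> K" if "k \<in> K" for k
    using that K(2) subgroup.m_closed[OF K(1)] by (auto simp: r_coset_def)
  ultimately show "K = \<Union>((\<lambda>k. H #> k) ` K)" by blast
  show "(\<lambda>k. H #> k) ` K \<subseteq> rcosets H"
    using rcosetsI[OF subgroup.subset[OF H]] subgroup.mem_carrier[OF K(1)] by blast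
qed

lemma finite_supergroups:
  assumes H: "subgroup H G" and "finite_index H G"
  shows "finite {K. subgroup K G \<and> H \<subseteq> K}"
proof -
  have "{K. subgroup K G \<and> H \<subseteq> K} \<subseteq> Union ` Pow (rcosets H)"
  proof
    fix K assume "K \<in> {K. subgroup K G \<and> H \<subseteq> K}"
    then have K: "subgroup K G" "H \<subseteq> K" by auto
    show "K \<in> Union ` Pow (rcosets H)"
      using supergroup_eq_Union_rcosets[OF H K] by (intro image_eqI PowI)
  qed
  then show ?thesis
    using assms(2) unfolding finite_index_def by (meson finite_Pow_iff finite_surj)
qed

section \<open>Relative normality and conjugates\<close>

text \<open>Translates normality in \<open>H\<close> into conditions using only the operations of
  \<open>G\<close>, in particular its inverse.\<close>

lemma normal_in_subgroup_iff:
  assumes H: "subgroup H G"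
  shows "K \<lhd> G\<lparr>carrier := H\<rparr> \<longleftrightarrow>
    subgroup K G \<and> K \<subseteq> H \<and> (\<forall>h\<in>H. \<forall>k\<in>K. h \<otimes> k \<otimes> inv h \<in> K)"
proof -
  interpret H: group "G\<lparr>carrier := H\<rparr>"
    using subgroup.subgroup_is_group[OF H is_group] .
  have "subgroup K (G\<lparr>carrier := H\<rparr>) \<longleftrightarrow> subgroup K G \<and> K \<subseteq> H"
    using incl_subgroup[OF H] subgroup_incl[OF _ H] subgroup.subset[of K "G\<lparr>carrier := H\<rparr>"] by auto
  then show ?thesis
    by (auto simp: H.normal_inv_iff m_inv_consistent[OF H])
qed

text \<open>With the preimage form, \<open>conjugate A g\<close> is \<open>g\<^sup>-\<^sup>1 A g\<close>, so conjugation is a right action and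
  closedness of conjugates is continuity.\<close>

definition conjugate :: "'a set \<Rightarrow> 'a \<Rightarrow> 'a set" where
  "conjugate A g = {x \<in> carrier G. g \<otimes> x \<otimes> inv g \<in> A}"

lemma conjugate_subset: "conjugate A g \<subseteq> carrier G"
  by (auto simp: conjugate_def)

lemma conjugate_one: "A \<subseteq> carrier G \<Longrightarrow> conjugate A \<one> = A"
  by (auto simp: conjugate_def)

lemma conjugate_mult:
  assumes "g \<in> carrier G" "h \<in> carrier G"
  shows "conjugate A (g \<otimes> h) = conjugate (conjugate A g) h"
  using assms by (auto simp: conjugate_def inv_mult_group m_assoc)

lemma conjugate_Int: "conjugate (A \<inter> B) g = conjugate A g \<inter> conjugate B g"
  by (auto simp: conjugate_def)

lemma conjugate_conj:
  assumes "x \<in> conjugate A g" "g \<in> carrier G" "h \<in> carrier G"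
  shows "h \<otimes> x \<otimes> inv h \<in> conjugate A (g \<otimes> inv h)"
proof -
  have x: "x \<in> carrier G" using assms by (auto simp: conjugate_def)
  have "(g \<otimes> inv h) \<otimes> (h \<otimes> x \<otimes> inv h) \<otimes> inv (g \<otimes> inv h) = g \<otimes> x \<otimes> inv g"
    using x assms by (simp add: inv_mult_group m_assoc l_inv_assoc)
  then show ?thesis using assms x by (auto simp: conjugate_def)
qed

lemma subgroup_conjugate:
  assumes A: "subgroup A G" and g: "g \<in> carrier G"
  shows "subgroup (conjugate A g) G"
proof (rule subgroupI)
  show "conjugate A g \<subseteq> carrier G" by (rule conjugate_subset)
  have "\<one> \<in> conjugate A g"
    using g subgroup.one_closed[OF A] by (simp add: conjugate_def)
  then show "conjugate A g \<noteq> {}" by blast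
next
  fix a assume "a \<in> conjugate A g"
  then have a: "a \<in> carrier G" "g \<otimes> a \<otimes> inv g \<in> A" by (auto simp: conjugate_def)
  have "inv (g \<otimes> a \<otimes> inv g) = g \<otimes> inv a \<otimes> inv g"
    using a g by (simp add: inv_mult_group m_assoc)
  then show "inv a \<in> conjugate A g"
    using subgroup.m_inv_closed[OF A a(2)] a by (simp add: conjugate_def)
next
  fix a b assume "a \<in> conjugate A g" "b \<in> conjugate A g"
  then have ab: "a \<in> carrier G" "g \<otimes> a \<otimes> inv g \<in> A" "b \<in> carrier G" "g \<otimes> b \<otimes> inv g \<in> A"
    by (auto simp: conjugate_def)
  have "(g \<otimes> a \<otimes> inv g) \<otimes> (g \<otimes> b \<otimes> inv g) = g \<otimes> (a \<otimes> b) \<otimes> inv g"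
    using ab g by (simp add: m_assoc l_inv_assoc)
  then show "a \<otimes> b \<in> conjugate A g"
    using subgroup.m_closed[OF A ab(2,4)] ab by (simp add: conjugate_def)
qed

text \<open>Translating a transversal of \<open>A\<close> on the left by \<open>inv g\<close> gives
  one for the conjugate.\<close>

lemma finite_index_conjugate:
  assumes A: "subgroup A G" and g: "g \<in> carrier G" and "finite_index A G"
  shows "finite_index (conjugate A g) G"
proof -
  obtain F where F: "finite F" "F \<subseteq> carrier G" "\<forall>x\<in>carrier G. \<exists>t\<in>F. x \<otimes> inv t \<in> A"
    using assms(3) unfolding finite_index_iff_transversal[OF A] by auto
  have "\<exists>t\<in>(\<lambda>t. inv g \<otimes> t) ` F. x \<otimes> inv t \<in> conjugate A g" if x: "x \<in> carrier G" for x
  proof -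
    obtain t where t: "t \<in> F" "(g \<otimes> x) \<otimes> inv t \<in> A" using F x g by (metis m_closed)
    then have tc: "t \<in> carrier G" using F by auto
    have "g \<otimes> (x \<otimes> inv (inv g \<otimes> t)) \<otimes> inv g = (g \<otimes> x) \<otimes> inv t"
      using x g tc by (simp add: inv_mult_group m_assoc)
    with t x g tc have "x \<otimes> inv (inv g \<otimes> t) \<in> conjugate A g"
      by (simp add: conjugate_def)
    then show ?thesis using t(1) by blast
  qed
  moreover have "finite ((\<lambda>t. inv g \<otimes> t) ` F)" "(\<lambda>t. inv g \<otimes> t) ` F \<subseteq> carrier G"
    using F g by auto
  ultimately show ?thesis
    unfolding finite_index_iff_transversal[OF subgroup_conjugate[OF A g]] by blast
qed

lemma conjugate_normal_in_subgroup:
  assumes H: "subgroup H G" and K: "K \<lhd> G\<lparr>carrier := H\<rparr>" and h: "h \<in> H"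
  shows "conjugate K h = K"
proof -
  have K': "subgroup K G" "K \<subseteq> H" "\<And>h k. h \<in> H \<Longrightarrow> k \<in> K \<Longrightarrow> h \<otimes> k \<otimes> inv h \<in> K"
    using K unfolding normal_in_subgroup_iff[OF H] by auto
  have hc: "h \<in> carrier G" using subgroup.mem_carrier[OF H h] .
  have "x \<in> K" if x: "x \<in> carrier G" "h \<otimes> x \<otimes> inv h \<in> K" for x
  proof -
    have "inv h \<otimes> (h \<otimes> x \<otimes> inv h) \<otimes> inv (inv h) \<in> K"
      using K'(3)[OF subgroup.m_inv_closed[OF H h] x(2)] .
    moreover have "inv h \<otimes> (h \<otimes> x \<otimes> inv h) \<otimes> inv (inv h) = x"
      using x hc by (simp add: m_assoc l_inv_assoc)
    ultimately show ?thesis by simp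
  qed
  then show ?thesis
    using K'(3)[OF h] subgroup.mem_carrier[OF K'(1)] by (auto simp: conjugate_def)
qed

lemma normal_subgroup_self: "subgroup H G \<Longrightarrow> H \<lhd> G\<lparr>carrier := H\<rparr>"
  by (simp add: normal_in_subgroup_iff subgroup.m_closed subgroup.m_inv_closed)

lemma conjugate_normal:
  assumes "N \<lhd> G" "g \<in> carrier G"
  shows "conjugate N g = N"
  using conjugate_normal_in_subgroup[OF subgroup_self] assms by simp

text \<open>Since \<open>H\<close> is normal, an element of \<open>H\<close> can be moved past
  \<open>g\<close> at the cost of replacing it by another element of \<open>H\<close>, and that one
  normalizes \<open>L\<close>.\<close>

lemma normal_conjugate_in_normal:
  assumes H: "H \<lhd> G" and L: "L \<lhd> G\<lparr>carrier := H\<rparr>" and g: "g \<in> carrier G"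
  shows "conjugate L g \<lhd> G\<lparr>carrier := H\<rparr>"
proof -
  have sH: "subgroup H G" using H by (rule normal_imp_subgroup)
  have L': "subgroup L G" "L \<subseteq> H" using L unfolding normal_in_subgroup_iff[OF sH] by auto
  show ?thesis
    unfolding normal_in_subgroup_iff[OF sH]
  proof (intro conjI ballI)
    show "subgroup (conjugate L g) G" by (rule subgroup_conjugate[OF L'(1) g])
    have "conjugate L g \<subseteq> conjugate H g" using L'(2) by (auto simp: conjugate_def)
    then show "conjugate L g \<subseteq> H" using conjugate_normal[OF H g] by simp
    fix h x assume h: "h \<in> H" and x: "x \<in> conjugate L g"
    have hc: "h \<in> carrier G" using subgroup.mem_carrier[OF sH h] .
    have gh: "g \<otimes> inv h \<otimes> inv g \<in> H"
      using normal.inv_op_closed2[OF H g] subgroup.m_inv_closed[OF sH h] by blast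
    have "g \<otimes> inv h = (g \<otimes> inv h \<otimes> inv g) \<otimes> g" using g hc by (simp add: m_assoc)
    then have "conjugate L (g \<otimes> inv h) = conjugate (conjugate L (g \<otimes> inv h \<otimes> inv g)) g"
      using conjugate_mult[of "g \<otimes> inv h \<otimes> inv g" g L] g hc by simp
    then have "conjugate L (g \<otimes> inv h) = conjugate L g"
      using conjugate_normal_in_subgroup[OF sH L gh] by simp
    then show "h \<otimes> x \<otimes> inv h \<in> conjugate L g"
      using conjugate_conj[OF x g hc] by simp
  qed
qed

text \<open>As \<open>H\<close> normalizes \<open>K\<close>, the conjugate by \<open>x\<close>
  depends only on the coset of \<open>H\<close> containing \<open>x\<close>. The case
  \<open>K = H\<close> gives the finiteness behind the core.\<close>

lemma finite_conjugates:
  assumes H: "subgroup H G" "finite_index H G" and K: "K \<lhd> G\<lparr>carrier := H\<rparr>"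
  shows "finite (conjugate K ` carrier G)"
proof -
  obtain F where F: "finite F" "F \<subseteq> carrier G" "\<forall>x\<in>carrier G. \<exists>t\<in>F. x \<otimes> inv t \<in> H"
    using H unfolding finite_index_iff_transversal[OF H(1)] by auto
  have "conjugate K x \<in> conjugate K ` F" if x: "x \<in> carrier G" for x
  proof -
    obtain t where t: "t \<in> F" "x \<otimes> inv t \<in> H" using F x by auto
    then have tc: "t \<in> carrier G" using F by auto
    have "x = (x \<otimes> inv t) \<otimes> t" using x tc by (simp add: m_assoc)
    then have "conjugate K x = conjugate (conjugate K (x \<otimes> inv t)) t"
      using conjugate_mult[of "x \<otimes> inv t" t K] x tc by simp
    also have "\<dots> = conjugate K t"
      using conjugate_normal_in_subgroup[OF H(1) K t(2)] by simp
    finally show ?thesis using t(1) by simp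
  qed
  then have "conjugate K ` carrier G \<subseteq> conjugate K ` F" by blast
  then show ?thesis using F(1) finite_surj by blast
qed

lemma subgroup_normalizer:
  assumes "L \<subseteq> carrier G"
  shows "subgroup {g \<in> carrier G. conjugate L g = L} G"
proof (rule subgroupI)
  show "{g \<in> carrier G. conjugate L g = L} \<noteq> {}"
    using conjugate_one[OF assms] by blast
next
  fix a assume a: "a \<in> {g \<in> carrier G. conjugate L g = L}"
  then have "conjugate L (inv a) = conjugate (conjugate L a) (inv a)" by simp
  also have "\<dots> = L" using a conjugate_mult[of a "inv a" L] conjugate_one[OF assms] by simp
  finally show "inv a \<in> {g \<in> carrier G. conjugate L g = L}" using a by simp
qed (auto simp: conjugate_mult)

section \<open>Normal cores and centralizers\<close>

definition core :: "'a set \<Rightarrow> 'a set" where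
  "core A = (\<Inter>g\<in>carrier G. conjugate A g)"

lemma core_subset: "A \<subseteq> carrier G \<Longrightarrow> core A \<subseteq> A"
  unfolding core_def using conjugate_one by blast

lemma core_normal:
  assumes A: "subgroup A G"
  shows "core A \<lhd> G"
proof -
  have "h \<otimes> x \<otimes> inv h \<in> conjugate A g"
    if "x \<in> core A" and g: "g \<in> carrier G" and h: "h \<in> carrier G" for x g h
  proof -
    have "x \<in> conjugate A (g \<otimes> h)" using that unfolding core_def by blast
    then show ?thesis
      using conjugate_conj[of x A "g \<otimes> h" h] g h by (simp add: m_assoc)
  qed
  moreover have "subgroup (core A) G"
    unfolding core_def using subgroup_conjugate[OF A] by (intro subgroups_Inter) auto
  ultimately show ?thesis
    unfolding normal_inv_iff by (auto simp: core_def)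
qed

lemma finite_index_core:
  assumes A: "subgroup A G" and "finite_index A G"
  shows "finite_index (core A) G"
proof -
  \<comment> \<open>The intersection is indexed by the finitely many conjugates instead of the
    possibly infinitely many conjugating elements.\<close>
  have "finite_index (carrier G \<inter> (\<Inter>B\<in>conjugate A ` carrier G. B)) G"
    using finite_index_INT[OF finite_conjugates[OF assms normal_subgroup_self[OF A]], of id]
      subgroup_conjugate[OF A] finite_index_conjugate[OF A _ assms(2)] by auto
  moreover have "carrier G \<inter> (\<Inter>B\<in>conjugate A ` carrier G. B) = core A"
    using conjugate_subset unfolding core_def by fast
  ultimately show ?thesis by simp
qed

text \<open>The commutator of \<open>a\<close> and \<open>b\<close> lies in both \<open>A\<close>
  and \<open>B\<close>, depending on how it is bracketed.\<close>

lemma normal_Int_trivial_commute: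
  assumes A: "A \<lhd> G" and B: "B \<lhd> G" and AB: "A \<inter> B = {\<one>}" and a: "a \<in> A" and b: "b \<in> B"
  shows "a \<otimes> b = b \<otimes> a"
proof -
  note sA = normal_imp_subgroup[OF A] and sB = normal_imp_subgroup[OF B]
  have ac: "a \<in> carrier G" and bc: "b \<in> carrier G"
    using subgroup.mem_carrier sA sB a b by metis+
  have "(a \<otimes> b \<otimes> inv a) \<otimes> inv b \<in> B"
    using normal.inv_op_closed2[OF B ac b] b sB by (simp add: subgroup.m_closed subgroup.m_inv_closed)
  moreover have "a \<otimes> (b \<otimes> inv a \<otimes> inv b) \<in> A"
    using normal.inv_op_closed2[OF A bc, of "inv a"] a sA
    by (simp add: subgroup.m_closed subgroup.m_inv_closed)
  moreover have "a \<otimes> (b \<otimes> inv a \<otimes> inv b) = (a \<otimes> b) \<otimes> inv (b \<otimes> a)"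
    "(a \<otimes> b \<otimes> inv a) \<otimes> inv b = (a \<otimes> b) \<otimes> inv (b \<otimes> a)"
    using ac bc by (simp_all add: m_assoc inv_mult_group)
  ultimately have "(a \<otimes> b) \<otimes> inv (b \<otimes> a) = \<one>" using AB by auto
  then show ?thesis using ac bc by (simp add: inv_solve_right')
qed

definition centralizer :: "'a set \<Rightarrow> 'a set" where
  "centralizer S = {x \<in> carrier G. \<forall>s\<in>S. x \<otimes> s = s \<otimes> x}"

lemma subgroup_centralizer:
  assumes "S \<subseteq> carrier G"
  shows "subgroup (centralizer S) G"
proof (rule subgroupI)
  show "centralizer S \<subseteq> carrier G" by (auto simp: centralizer_def)
  have "\<one> \<in> centralizer S" using assms by (auto simp: centralizer_def)
  then show "centralizer S \<noteq> {}" by blast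
next
  fix a assume a: "a \<in> centralizer S"
  have "inv a \<otimes> s = s \<otimes> inv a" if "s \<in> S" for s
  proof -
    have c: "a \<in> carrier G" "s \<in> carrier G" "a \<otimes> s = s \<otimes> a"
      using a that assms by (auto simp: centralizer_def)
    have "inv a \<otimes> s = inv a \<otimes> (s \<otimes> a) \<otimes> inv a" using c(1,2) by (simp add: m_assoc)
    also have "\<dots> = inv a \<otimes> (a \<otimes> s) \<otimes> inv a" using c by simp
    also have "\<dots> = s \<otimes> inv a" using c(1,2) by (simp add: m_assoc[symmetric])
    finally show ?thesis .
  qed
  with a show "inv a \<in> centralizer S" by (auto simp: centralizer_def)
next
  fix a b assume ab: "a \<in> centralizer S" "b \<in> centralizer S"
  have "a \<otimes> b \<otimes> s = s \<otimes> (a \<otimes> b)" if "s \<in> S" for s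
  proof -
    have c: "a \<in> carrier G" "b \<in> carrier G" "s \<in> carrier G" "a \<otimes> s = s \<otimes> a" "b \<otimes> s = s \<otimes> b"
      using ab that assms by (auto simp: centralizer_def)
    have "a \<otimes> b \<otimes> s = a \<otimes> s \<otimes> b" using c(1-3,5) by (simp add: m_assoc)
    also have "\<dots> = s \<otimes> a \<otimes> b" by (simp only: c(4))
    also have "\<dots> = s \<otimes> (a \<otimes> b)" by (rule m_assoc[OF c(3,1,2)])
    finally show ?thesis .
  qed
  with ab show "a \<otimes> b \<in> centralizer S" by (auto simp: centralizer_def)
qed

text \<open>The element \<open>inv g \<otimes> s \<otimes> g\<close> of \<open>S\<close> commutes
  with \<open>x\<close>; conjugating back by \<open>g\<close> gives the claim. \<open>S\<close> is a
  mere set because it will be a normal subgroup in one use and a union of conjugates in the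
  other.\<close>

lemma centralizer_conj_closed:
  assumes S: "S \<subseteq> carrier G" and g: "g \<in> carrier G" and x: "x \<in> centralizer S"
    and inv: "\<And>s. s \<in> S \<Longrightarrow> inv g \<otimes> s \<otimes> g \<in> S"
  shows "g \<otimes> x \<otimes> inv g \<in> centralizer S"
proof -
  have xc: "x \<in> carrier G" using x by (auto simp: centralizer_def)
  have "(g \<otimes> x \<otimes> inv g) \<otimes> s = s \<otimes> (g \<otimes> x \<otimes> inv g)" if s: "s \<in> S" for s
  proof -
    have sc: "s \<in> carrier G" using S s by auto
    have c: "x \<otimes> (inv g \<otimes> s \<otimes> g) = (inv g \<otimes> s \<otimes> g) \<otimes> x"
      using x inv[OF s] by (auto simp: centralizer_def)
    have "(g \<otimes> x \<otimes> inv g) \<otimes> s = g \<otimes> (x \<otimes> (inv g \<otimes> s \<otimes> g)) \<otimes> inv g"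
      using xc sc g by (simp add: m_assoc)
    also have "\<dots> = g \<otimes> ((inv g \<otimes> s \<otimes> g) \<otimes> x) \<otimes> inv g" using c by simp
    also have "\<dots> = s \<otimes> (g \<otimes> x \<otimes> inv g)"
      using xc sc g by (simp add: m_assoc[symmetric])
    finally show ?thesis .
  qed
  then show ?thesis using xc g by (auto simp: centralizer_def)
qed

end

section \<open>Closedness\<close>

context topological_group
begin

section \<open>Closed sets in a topological group\<close>

lemma continuous_map_mult:
  assumes "continuous_map X T f" "continuous_map X T g"
  shows "continuous_map X T (\<lambda>x. f x \<otimes> g x)"
  using continuous_map_compose[OF continuous_map_pairedI[OF assms] continuous_mult]
  by (simp add: o_def)

lemma continuous_map_conj:
  assumes "g \<in> carrier G"
  shows "continuous_map T T (\<lambda>x. g \<otimes> x \<otimes> inv g)"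
  using assms by (intro continuous_map_mult) (auto simp: topspace_eq_carrier continuous_map_id[unfolded id_def])

lemma closedin_conjugate:
  assumes "closedin T A" "g \<in> carrier G"
  shows "closedin T (conjugate A g)"
  using closedin_continuous_map_preimage[OF continuous_map_conj[OF assms(2)] assms(1)]
  by (simp add: conjugate_def topspace_eq_carrier)

lemma closedin_core:
  assumes "closedin T A"
  shows "closedin T (core A)"
  unfolding core_def using closedin_conjugate[OF assms] by (intro closedin_Inter) auto

lemma closedin_rcoset:
  assumes "closedin T A" "g \<in> carrier G"
  shows "closedin T (A #> g)"
proof -
  have A: "A \<subseteq> carrier G" using closedin_subset[OF assms(1)] topspace_eq_carrier by simp
  have "continuous_map T T (\<lambda>x. x \<otimes> inv g)"
    using assms(2) by (intro continuous_map_mult) (auto simp: topspace_eq_carrier continuous_map_id[unfolded id_def])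
  then have "closedin T {x \<in> carrier G. x \<otimes> inv g \<in> A}"
    using closedin_continuous_map_preimage assms(1) topspace_eq_carrier by fastforce
  moreover have "{x \<in> carrier G. x \<otimes> inv g \<in> A} = A #> g"
  proof (intro equalityI subsetI)
    fix x assume x: "x \<in> {x \<in> carrier G. x \<otimes> inv g \<in> A}"
    then have "x = (x \<otimes> inv g) \<otimes> g" using assms(2) by (simp add: m_assoc)
    then show "x \<in> A #> g" using x by (auto simp: r_coset_def)
  next
    fix x assume "x \<in> A #> g"
    then show "x \<in> {x \<in> carrier G. x \<otimes> inv g \<in> A}"
      using A assms(2) by (auto simp: r_coset_def m_assoc subset_iff)
  qed
  ultimately show ?thesis by simp
qed

text \<open>\<open>K\<close> is a finite union of closed cosets of \<open>H\<close>. Normalizers and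
  other overgroups thus need no separate topological argument.\<close>

lemma closedin_supergroup:
  assumes H: "subgroup H G" "closedin T H" "finite_index H G" and K: "subgroup K G" "H \<subseteq> K"
  shows "closedin T K"
proof -
  have "finite ((\<lambda>k. H #> k) ` K)"
    using supergroup_eq_Union_rcosets(2)[OF H(1) K] H(3) unfolding finite_index_def
    by (rule finite_subset)
  then have "closedin T (\<Union>((\<lambda>k. H #> k) ` K))"
    using closedin_rcoset[OF H(2)] subgroup.mem_carrier[OF K(1)] by (intro closedin_Union) auto
  then show ?thesis using supergroup_eq_Union_rcosets(1)[OF H(1) K] by simp
qed

text \<open>The trivial subgroup is an intersection of closed subgroups. This is the separation
  property that makes centralizers closed.\<close>

lemma residually_finite_closedin_one:
  assumes "residually_finite G T"
  shows "closedin T {\<one>}"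
proof -
  \<comment> \<open>Shows that the family being intersected is non-empty, as
    \<open>closedin_Inter\<close> requires.\<close>
  have "closed_normal (carrier G) G T \<and> finite_index (carrier G) G"
    using closedin_topspace[of T] normal_subgroup_self[OF subgroup_self] finite_index_carrier
    by (simp add: closed_normal_def topspace_eq_carrier)
  then have "closedin T (\<Inter> {N. closed_normal N G T \<and> finite_index N G})"
    by (intro closedin_Inter) (auto simp: closed_normal_def)
  then show ?thesis using assms by (simp add: residually_finite_def)
qed

lemma closedin_centralizer:
  assumes one: "closedin T {\<one>}" and S: "S \<subseteq> carrier G"
  shows "closedin T (centralizer S)"
proof -
  have "closedin T {x \<in> carrier G. x \<otimes> s = s \<otimes> x}" if s: "s \<in> carrier G" for s
  proof -
    \<comment> \<open>Commuting with \<open>s\<close> becomes membership in the preimage of the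
      closed set \<open>{\<one>}\<close>.\<close>
    have "continuous_map T T (\<lambda>x. (x \<otimes> s) \<otimes> inv (s \<otimes> x))"
      using s by (intro continuous_map_mult continuous_map_compose[OF _ continuous_inv, unfolded o_def])
        (auto simp: topspace_eq_carrier continuous_map_id[unfolded id_def])
    then have "closedin T {x \<in> carrier G. (x \<otimes> s) \<otimes> inv (s \<otimes> x) \<in> {\<one>}}"
      using closedin_continuous_map_preimage one topspace_eq_carrier by fastforce
    moreover have "(x \<otimes> s) \<otimes> inv (s \<otimes> x) = \<one> \<longleftrightarrow> x \<otimes> s = s \<otimes> x" if "x \<in> carrier G" for x
      using that s by (simp add: inv_solve_right')
    ultimately show ?thesis by (simp cong: conj_cong)
  qed
  \<comment> \<open>Inserting \<open>carrier G\<close> covers the case of empty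
    \<open>S\<close>.\<close>
  then have "closedin T (\<Inter>(insert (carrier G) ((\<lambda>s. {x \<in> carrier G. x \<otimes> s = s \<otimes> x}) ` S)))"
    using S closedin_topspace[of T] by (intro closedin_Inter) (auto simp: topspace_eq_carrier)
  moreover have "\<Inter>(insert (carrier G) ((\<lambda>s. {x \<in> carrier G. x \<otimes> s = s \<otimes> x}) ` S)) = centralizer S"
    by (auto simp: centralizer_def)
  ultimately show ?thesis by simp
qed

section \<open>Closed subgroups as topological groups\<close>

lemma closed_normal_in_subgroup_iff:
  assumes "closed_subgroup H G T"
  shows "closed_normal K (G\<lparr>carrier := H\<rparr>) (subtopology T H) \<longleftrightarrow>
    K \<lhd> G\<lparr>carrier := H\<rparr> \<and> closedin T K"
  using assms normal_in_subgroup_iff[of H K] closedin_closed_subtopology[of T H K]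
  unfolding closed_subgroup_def closed_normal_def by auto

text \<open>Only finitely many subgroups contain \<open>A\<close>, so a maximal element among the
  proper closed ones exists without Zorn's lemma.\<close>

lemma maximal_subgroup_exists:
  assumes A: "closed_subgroup A G T" "finite_index A G" "A \<noteq> carrier G"
  obtains M where "maximal_subgroup M G T" "A \<subseteq> M"
proof -
  define \<M> where "\<M> = {K. closed_subgroup K G T \<and> K \<noteq> carrier G \<and> A \<subseteq> K}"
  have "finite \<M>"
    using A by (intro finite_subset[OF _ finite_supergroups[of A]])
      (auto simp: \<M>_def closed_subgroup_def)
  moreover have "A \<in> \<M>" using A by (simp add: \<M>_def)
  ultimately obtain M where M: "M \<in> \<M>" "A \<subseteq> M" "\<forall>K\<in>\<M>. M \<subseteq> K \<longrightarrow> M = K"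
    using finite_has_maximal2 by metis
  then have "maximal_subgroup M G T"
    unfolding maximal_subgroup_def \<M>_def by blast
  with M(2) show thesis using that by blast
qed

text \<open>Intersecting the closed normal finite index subgroups of \<open>G\<close> with
  \<open>H\<close> already gives enough such subgroups of \<open>H\<close>.\<close>

lemma residually_finite_subgroup:
  assumes res: "residually_finite G T" and H: "closed_subgroup H G T" "finite_index H G"
  shows "residually_finite (G\<lparr>carrier := H\<rparr>) (subtopology T H)"
proof -
  have sH: "subgroup H G" "closedin T H" using H by (auto simp: closed_subgroup_def)
  let ?S = "{N. closed_normal N (G\<lparr>carrier := H\<rparr>) (subtopology T H) \<and> finite_index N (G\<lparr>carrier := H\<rparr>)}"
  have "N \<inter> H \<in> ?S" if N: "closed_normal N G T" "finite_index N G" for N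
  proof -
    have N': "N \<lhd> G" "closedin T N" "subgroup N G"
      using N normal_imp_subgroup by (auto simp: closed_normal_def)
    have "N \<inter> H \<lhd> G\<lparr>carrier := H\<rparr>"
      unfolding normal_in_subgroup_iff[OF sH(1)]
      using N' sH(1) subgroups_Inter_pair normal.inv_op_closed2[OF N'(1)] subgroup.mem_carrier[OF sH(1)]
      by (auto simp: subgroup.m_closed subgroup.m_inv_closed)
    then show ?thesis
      using N' sH finite_index_subgroup[OF sH(1) finite_index_Int[OF N'(3) sH(1) N(2) H(2)]]
      by (auto simp: closed_normal_in_subgroup_iff[OF H(1)])
  qed
  then have "\<Inter>?S \<subseteq> \<Inter> {N. closed_normal N G T \<and> finite_index N G}" by blast
  then have "\<Inter>?S \<subseteq> {\<one>}" using res by (simp add: residually_finite_def)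
  moreover have "\<one> \<in> \<Inter>?S"
    unfolding closed_normal_in_subgroup_iff[OF H(1)] normal_in_subgroup_iff[OF sH(1)]
    by (auto dest: subgroup.one_closed)
  ultimately show ?thesis
    unfolding residually_finite_def by auto
qed

text \<open>For \<open>H\<close> of finite index in \<open>G\<close>, infinitude and residual
  finiteness are inherited, so only the condition on normal subgroups remains. Here and in the
  converse rule the index is measured in \<open>G\<close>, so that later arguments stay in one
  group.\<close>

lemma just_infinite_subgroupI:
  assumes "just_infinite G T" and H: "closed_subgroup H G T" "finite_index H G"
    and fin: "\<And>K. K \<lhd> G\<lparr>carrier := H\<rparr> \<Longrightarrow> closedin T K \<Longrightarrow> K \<noteq> {\<one>} \<Longrightarrow> finite_index K G"
  shows "just_infinite_subgroup H G T"
proof -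
  have sH: "subgroup H G" using H by (auto simp: closed_subgroup_def)
  have "infinite H"
    using assms(1) finite_carrier_if_finite_index[OF sH H(2)] by (auto simp: just_infinite_def)
  moreover have "residually_finite (G\<lparr>carrier := H\<rparr>) (subtopology T H)"
    using residually_finite_subgroup H assms(1) by (auto simp: just_infinite_def)
  ultimately show ?thesis
    using finite_index_subgroup[OF sH fin]
    unfolding just_infinite_def closed_normal_in_subgroup_iff[OF H(1)] by auto
qed

lemma just_infinite_subgroupD:
  assumes ji: "just_infinite_subgroup H G T" and H: "closed_subgroup H G T" "finite_index H G"
    and K: "K \<lhd> G\<lparr>carrier := H\<rparr>" "closedin T K" "K \<noteq> {\<one>}"
  shows "finite_index K G"
proof -
  have sH: "subgroup H G" using H by (auto simp: closed_subgroup_def)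
  have "finite_index K (G\<lparr>carrier := H\<rparr>)"
    using ji K unfolding just_infinite_def closed_normal_in_subgroup_iff[OF H(1)] by auto
  then show ?thesis
    using finite_index_trans[OF sH _ _ H(2)] K(1) unfolding normal_in_subgroup_iff[OF sH] by blast
qed

section \<open>Just infinite groups\<close>

lemma just_infinite_virtually_abelianI:
  assumes ji: "just_infinite G T"
    and Q: "closed_subgroup Q G T" "finite_index Q G"
    and x: "x \<in> centralizer Q" "x \<noteq> \<one>"
  shows "virtually_abelian G T"
proof -
  have sQ: "subgroup Q G" "closedin T Q" using Q by (auto simp: closed_subgroup_def)
  \<comment> \<open>Passing to the core makes the centralizer normal in \<open>G\<close>; since
    \<open>R \<subseteq> Q\<close>, it still contains \<open>x\<close>.\<close>
  define R where "R = core Q"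
  define C where "C = centralizer R"
  have R: "R \<lhd> G" "subgroup R G" "closedin T R" "finite_index R G" "R \<subseteq> Q"
    unfolding R_def using core_normal[OF sQ(1)] normal_imp_subgroup closedin_core[OF sQ(2)]
      finite_index_core[OF sQ(1) Q(2)] core_subset[OF subgroup.subset[OF sQ(1)]] by auto
  have Rc: "R \<subseteq> carrier G" using subgroup.subset[OF R(2)] .
  have sC: "subgroup C G" unfolding C_def by (rule subgroup_centralizer[OF Rc])
  have "C \<lhd> G"
    unfolding normal_inv_iff
    using sC centralizer_conj_closed[OF Rc] normal.inv_op_closed1[OF R(1)] by (auto simp: C_def)
  moreover have clC: "closedin T C"
    using closedin_centralizer[OF residually_finite_closedin_one Rc] ji
    by (auto simp: C_def just_infinite_def)
  moreover have "x \<in> C"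
    using x R(5) by (auto simp: C_def centralizer_def)
  then have "C \<noteq> {\<one>}" using x(2) by blast
  ultimately have "finite_index C G"
    using ji by (auto simp: just_infinite_def closed_normal_def)
  then have fin: "finite_index (R \<inter> C) G"
    using finite_index_Int R sC by blast
  have sub: "subgroup (R \<inter> C) G" using subgroups_Inter_pair R sC by blast
  interpret A: group "G\<lparr>carrier := R \<inter> C\<rparr>"
    using subgroup.subgroup_is_group[OF sub is_group] .
  have "comm_group (G\<lparr>carrier := R \<inter> C\<rparr>)"
  proof (rule A.group_comm_groupI)
    fix a b
    assume "a \<in> carrier (G\<lparr>carrier := R \<inter> C\<rparr>)" "b \<in> carrier (G\<lparr>carrier := R \<inter> C\<rparr>)"
    then have "a \<in> centralizer R" "b \<in> R" by (simp_all add: C_def)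
    then have "a \<otimes> b = b \<otimes> a" unfolding centralizer_def by blast
    then show "a \<otimes>\<^bsub>G\<lparr>carrier := R \<inter> C\<rparr>\<^esub> b = b \<otimes>\<^bsub>G\<lparr>carrier := R \<inter> C\<rparr>\<^esub> a" by simp
  qed
  then show ?thesis
    unfolding virtually_abelian_def closed_subgroup_def using sub fin R(3) clC by blast
qed

section \<open>From a normal subgroup up to its overgroups\<close>

text \<open>\<open>M\<close> is an arbitrary overgroup because the hereditary statement climbs from
  the core of a finite index subgroup to that subgroup.\<close>

lemma just_infinite_supergroup:
  assumes ji: "just_infinite G T" and nva: "\<not> virtually_abelian G T"
    and H: "closed_normal H G T" "finite_index H G" "just_infinite_subgroup H G T"
    and M: "subgroup M G" "H \<subseteq> M"
  shows "just_infinite_subgroup M G T"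
proof -
  have H': "H \<lhd> G" "closedin T H" "subgroup H G" "closed_subgroup H G T"
    using H normal_imp_subgroup by (auto simp: closed_normal_def closed_subgroup_def)
  have finM: "finite_index M G" using finite_index_mono[OF H'(3) M H(2)] .
  have clM: "closed_subgroup M G T"
    using closedin_supergroup[OF H'(3,2) H(2) M] M by (simp add: closed_subgroup_def)
  show ?thesis
  proof (rule just_infinite_subgroupI[OF ji clM finM])
    fix K assume K: "K \<lhd> G\<lparr>carrier := M\<rparr>" "closedin T K" "K \<noteq> {\<one>}"
    have K': "subgroup K G" "K \<subseteq> M" "\<And>h k. h \<in> M \<Longrightarrow> k \<in> K \<Longrightarrow> h \<otimes> k \<otimes> inv h \<in> K"
      using K(1) unfolding normal_in_subgroup_iff[OF M(1)] by auto
    have KH: "subgroup (K \<inter> H) G" using subgroups_Inter_pair K' H' by blast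
    show "finite_index K G"
    proof (cases "K \<inter> H = {\<one>}")
      case False
      have "K \<inter> H \<lhd> G\<lparr>carrier := H\<rparr>"
        unfolding normal_in_subgroup_iff[OF H'(3)]
        using KH K'(3) M(2) H'(3) by (auto simp: subgroup.m_closed subgroup.m_inv_closed)
      then have "finite_index (K \<inter> H) G"
        using just_infinite_subgroupD[OF H(3) H'(4) H(2)] K(2) H'(2) False by blast
      then show ?thesis using finite_index_mono[OF KH K'(1)] by blast
    next
      case True
      interpret M: group "G\<lparr>carrier := M\<rparr>"
        using subgroup.subgroup_is_group[OF M(1) is_group] .
      obtain x where x: "x \<in> K" "x \<noteq> \<one>"
        using K(3) subgroup.one_closed[OF K'(1)] by blast
      \<comment> \<open>\<open>K\<close> and \<open>H\<close> are both normal in \<open>M\<close>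
        and meet trivially, so they commute elementwise.\<close>
      have "H \<lhd> G\<lparr>carrier := M\<rparr>"
        unfolding normal_in_subgroup_iff[OF M(1)]
        using H' M normal.inv_op_closed2[OF H'(1)] subgroup.mem_carrier[OF M(1)] by auto
      then have "x \<in> centralizer H"
        using M.normal_Int_trivial_commute[OF K(1), of H x] x True subgroup.mem_carrier[OF K'(1)]
        by (auto simp: centralizer_def)
      then show ?thesis
        using just_infinite_virtually_abelianI[OF ji H'(4) H(2)] x nva by blast
    qed
  qed
qed

section \<open>From maximal subgroups down to a normal subgroup\<close>

text \<open>\<open>K\<close> has finitely many conjugates, so minimal non-trivial intersections of
  them exist. For such an \<open>L\<close>, its intersection with a conjugate of itself is again an
  intersection of conjugates of \<open>K\<close>, hence trivial or equal to
  \<open>L\<close>.\<close>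

lemma trivial_intersection_conjugates:
  assumes H: "subgroup H G" "finite_index H G" "H \<lhd> G"
    and K: "K \<lhd> G\<lparr>carrier := H\<rparr>" "closedin T K" "K \<noteq> {\<one>}"
  obtains L where "L \<lhd> G\<lparr>carrier := H\<rparr>" "closedin T L" "L \<noteq> {\<one>}" "L \<subseteq> K"
    "\<And>g. g \<in> carrier G \<Longrightarrow> conjugate L g = L \<or> L \<inter> conjugate L g = {\<one>}"
proof -
  have K': "subgroup K G" "K \<subseteq> H"
    using K(1) unfolding normal_in_subgroup_iff[OF H(1)] by auto
  let ?C = "conjugate K ` carrier G"
  \<comment> \<open>\<open>L\<close> will be a minimal non-trivial intersection of conjugates of \<open>K\<close>.\<close>
  define \<L> where "\<L> = {L. \<exists>\<C>\<subseteq>?C. \<C> \<noteq> {} \<and> L = \<Inter>\<C> \<and> L \<noteq> {\<one>}}"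
  have "\<L> \<subseteq> Inter ` Pow ?C" by (auto simp: \<L>_def)
  then have fin: "finite \<L>"
    using finite_conjugates[OF H(1,2) K(1)] by (meson finite_Pow_iff finite_surj)
  have "K = conjugate K \<one>" using conjugate_one subgroup.subset[OF K'(1)] by simp
  then have "K \<in> ?C" by blast
  then have "K \<in> \<L>" unfolding \<L>_def using K(3)
    by (intro CollectI exI[of _ "{K}"]) auto
  then obtain L where L: "L \<in> \<L>" "L \<subseteq> K" "\<forall>A\<in>\<L>. A \<subseteq> L \<longrightarrow> L = A"
    using finite_has_minimal2[OF fin] by metis
  obtain \<C> where \<C>: "\<C> \<subseteq> ?C" "\<C> \<noteq> {}" "L = \<Inter>\<C>" "L \<noteq> {\<one>}"
    using L(1) by (auto simp: \<L>_def)
  have sL: "subgroup L G"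
    using subgroup_conjugate[OF K'(1)] \<C> by (auto intro!: subgroups_Inter)
  have clL: "closedin T L"
    using closedin_conjugate[OF K(2)] \<C> by (auto intro!: closedin_Inter)
  have "h \<otimes> x \<otimes> inv h \<in> conjugate K g"
    if "h \<in> H" "g \<in> carrier G" "x \<in> conjugate K g" for h x g
    using normal_conjugate_in_normal[OF H(3) K(1)] that unfolding normal_in_subgroup_iff[OF H(1)]
    by blast
  then have "h \<otimes> x \<otimes> inv h \<in> A" if "h \<in> H" "x \<in> L" "A \<in> \<C>" for h x A
    using that \<C>(1) unfolding \<C>(3) by blast
  then have "h \<otimes> x \<otimes> inv h \<in> L" if "h \<in> H" "x \<in> L" for h x
    using that by (subst \<C>(3)) (rule InterI)
  then have nL: "L \<lhd> G\<lparr>carrier := H\<rparr>"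
    unfolding normal_in_subgroup_iff[OF H(1)] using sL L(2) K'(2) by blast
  have sub: "L \<subseteq> conjugate L g" if g: "g \<in> carrier G" and ne: "L \<inter> conjugate L g \<noteq> {\<one>}" for g
  proof -
    \<comment> \<open>Uses that the family is non-empty: conjugates lie in \<open>carrier G\<close>,
      whereas an empty intersection is \<open>UNIV\<close>.\<close>
    have eq: "conjugate L g = \<Inter>((\<lambda>A. conjugate A g) ` \<C>)"
      unfolding \<C>(3) using \<C>(2) by (auto simp: conjugate_def)
    have "(\<lambda>A. conjugate A g) ` \<C> \<subseteq> ?C"
    proof
      fix B assume "B \<in> (\<lambda>A. conjugate A g) ` \<C>"
      then obtain k where k: "k \<in> carrier G" "B = conjugate (conjugate K k) g"
        using \<C>(1) by blast
      then have "B = conjugate K (k \<otimes> g)" using conjugate_mult g by simp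
      then show "B \<in> ?C" using k g by blast
    qed
    then have "\<C> \<union> (\<lambda>A. conjugate A g) ` \<C> \<subseteq> ?C" using \<C>(1) by (rule Un_least[rotated])
    moreover have "L \<inter> conjugate L g = \<Inter>(\<C> \<union> (\<lambda>A. conjugate A g) ` \<C>)"
      by (simp only: Inter_Un_distrib eq[symmetric] \<C>(3)[symmetric])
    ultimately have "L \<inter> conjugate L g \<in> \<L>"
      unfolding \<L>_def using ne \<C>(2)
      by (intro CollectI exI[of _ "\<C> \<union> (\<lambda>A. conjugate A g) ` \<C>"]) simp
    then show ?thesis using L(3) by blast
  qed
  have "conjugate L g = L \<or> L \<inter> conjugate L g = {\<one>}" if g: "g \<in> carrier G" for g
  proof (cases "L \<inter> conjugate L g = {\<one>}")
    case False
    \<comment> \<open>Minimality gives only \<open>L \<subseteq> conjugate L g\<close>. The reverse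
      inclusion comes from \<open>sub\<close> at \<open>inv g\<close>, whose hypothesis is obtained
      by conjugating the non-trivial intersection by \<open>inv g\<close>.\<close>
    have undo: "conjugate (conjugate L g) (inv g) = L"
      using conjugate_mult[of g "inv g" L] conjugate_one[OF subgroup.subset[OF sL]] g by simp
    have "conjugate (L \<inter> conjugate L g) (inv g) = conjugate L (inv g) \<inter> L"
      by (simp add: conjugate_Int undo)
    moreover have "conjugate (L \<inter> conjugate L g) (inv g) \<noteq> {\<one>}"
    proof
      assume "conjugate (L \<inter> conjugate L g) (inv g) = {\<one>}"
      then have "conjugate (conjugate (L \<inter> conjugate L g) (inv g)) g = conjugate {\<one>} g" by simp
      then have "L \<inter> conjugate L g = conjugate {\<one>} g"
        using conjugate_mult[of "inv g" g "L \<inter> conjugate L g"] conjugate_one[of "L \<inter> conjugate L g"]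
          subgroup.subset[OF sL] g by auto
      also have "\<dots> = {\<one>}" by (rule conjugate_normal[OF one_is_normal g])
      finally show False using False by simp
    qed
    ultimately have "L \<inter> conjugate L (inv g) \<noteq> {\<one>}" by (simp add: Int_commute)
    then have "L \<subseteq> conjugate L (inv g)" using sub g by simp
    then have "conjugate L g \<subseteq> conjugate (conjugate L (inv g)) g"
      by (auto simp: conjugate_def)
    also have "\<dots> = L"
      using conjugate_mult[of "inv g" g L] conjugate_one[OF subgroup.subset[OF sL]] g by simp
    finally show ?thesis using sub[OF g False] by blast
  qed simp
  then show thesis
    using that nL clL \<C>(4) L(2) by blast
qed

text \<open>Finite index of \<open>H\<close> takes the place of non-triviality, so the same lemma
  serves a non-trivial normal subgroup and the core of a finite index subgroup.\<close>

lemma just_infinite_normal_subgroup: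
  assumes ji: "just_infinite G T" and nva: "\<not> virtually_abelian G T"
    and H: "closed_normal H G T" "finite_index H G"
    and max: "\<And>M. maximal_subgroup M G T \<Longrightarrow> H \<subseteq> M \<Longrightarrow> just_infinite_subgroup M G T"
  shows "just_infinite_subgroup H G T"
proof -
  have H': "H \<lhd> G" "closedin T H" "subgroup H G" "closed_subgroup H G T"
    using H normal_imp_subgroup by (auto simp: closed_normal_def closed_subgroup_def)
  interpret H: group "G\<lparr>carrier := H\<rparr>"
    using subgroup.subgroup_is_group[OF H'(3) is_group] .
  show ?thesis
  proof (rule just_infinite_subgroupI[OF ji H'(4) H(2)])
    fix K assume K: "K \<lhd> G\<lparr>carrier := H\<rparr>" "closedin T K" "K \<noteq> {\<one>}"
    then obtain L where L: "L \<lhd> G\<lparr>carrier := H\<rparr>" "closedin T L" "L \<noteq> {\<one>}" "L \<subseteq> K"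
      and dich: "\<And>g. g \<in> carrier G \<Longrightarrow> conjugate L g = L \<or> L \<inter> conjugate L g = {\<one>}"
      using trivial_intersection_conjugates[OF H'(3) H(2) H'(1) K] by metis
    have L': "subgroup L G" "L \<subseteq> H"
      using L(1) unfolding normal_in_subgroup_iff[OF H'(3)] by auto
    have Lc: "L \<subseteq> carrier G" using subgroup.subset[OF L'(1)] .
    have sK: "subgroup K G"
      using K(1) unfolding normal_in_subgroup_iff[OF H'(3)] by auto
    define N where "N = {g \<in> carrier G. conjugate L g = L}"
    have N: "subgroup N G" unfolding N_def by (rule subgroup_normalizer[OF Lc])
    have HN: "H \<subseteq> N"
      using conjugate_normal_in_subgroup[OF H'(3) L(1)] subgroup.mem_carrier[OF H'(3)]
      by (auto simp: N_def)
    show "finite_index K G"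
    \<comment> \<open>The first case includes \<open>H = carrier G\<close>, where no maximal
      subgroup contains \<open>H\<close>.\<close>
    proof (cases "N = carrier G")
      case True
      have "g \<otimes> x \<otimes> inv g \<in> L" if g: "g \<in> carrier G" and x: "x \<in> L" for g x
      proof -
        have "conjugate L g = L" using True g by (auto simp: N_def)
        then have "x \<in> conjugate L g" using x by simp
        then show ?thesis by (simp add: conjugate_def)
      qed
      then have "L \<lhd> G" unfolding normal_inv_iff using L'(1) by blast
      then have "finite_index L G"
        using ji L(2,3) by (auto simp: just_infinite_def closed_normal_def)
      then show ?thesis using finite_index_mono[OF L'(1) sK L(4)] by blast
    next
      case False
      have "closed_subgroup N G T"
        using closedin_supergroup[OF H'(3,2) H(2) N HN] N by (simp add: closed_subgroup_def)
      then obtain M where M: "maximal_subgroup M G T" "N \<subseteq> M"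
        using maximal_subgroup_exists[OF _ finite_index_mono[OF H'(3) N HN H(2)] False] by blast
      have M': "subgroup M G" "closed_subgroup M G T" "M \<noteq> carrier G"
        using M(1) by (auto simp: maximal_subgroup_def closed_subgroup_def)
      have finM: "finite_index M G" using finite_index_mono[OF H'(3) M'(1) _ H(2)] HN M(2) by blast
      have jiM: "just_infinite_subgroup M G T" using max M HN by blast
      \<comment> \<open>Centralizing the conjugates of \<open>L\<close> outside \<open>M\<close> yields a closed normal subgroup of \<open>M\<close> that
        contains \<open>L\<close>, with no need to close up the normal closure of \<open>L\<close> in \<open>M\<close>.\<close>
      define S where "S = (\<Union>g\<in>carrier G - M. conjugate L g)"
      define Q where "Q = M \<inter> centralizer S"
      have S: "S \<subseteq> carrier G" using conjugate_subset by (auto simp: S_def)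
      \<comment> \<open>Right multiplication by \<open>m\<close> preserves the complement of
        \<open>M\<close>, so \<open>M\<close> permutes the conjugates that make up
        \<open>S\<close>.\<close>
      have Sinv: "inv m \<otimes> s \<otimes> m \<in> S" if m: "m \<in> M" and s: "s \<in> S" for m s
      proof -
        obtain g where g: "g \<in> carrier G" "g \<notin> M" "s \<in> conjugate L g"
          using s by (auto simp: S_def)
        have mc: "m \<in> carrier G" using subgroup.mem_carrier[OF M'(1) m] .
        have "inv m \<otimes> s \<otimes> inv (inv m) \<in> conjugate L (g \<otimes> inv (inv m))"
          using conjugate_conj[OF g(3,1)] mc by blast
        then have "inv m \<otimes> s \<otimes> m \<in> conjugate L (g \<otimes> m)" using mc by simp
        moreover have "g \<otimes> m \<notin> M"
        proof
          assume "g \<otimes> m \<in> M"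
          then have "(g \<otimes> m) \<otimes> inv m \<in> M"
            using m M'(1) by (simp add: subgroup.m_closed subgroup.m_inv_closed)
          then show False using g mc by (simp add: m_assoc)
        qed
        ultimately show ?thesis using g mc by (auto simp: S_def)
      qed
      have sQ: "subgroup Q G"
        unfolding Q_def using subgroups_Inter_pair[OF M'(1) subgroup_centralizer[OF S]] .
      have clQ: "closedin T Q"
        unfolding Q_def using M'(2) closedin_centralizer[OF residually_finite_closedin_one S] ji
        by (auto simp: closed_subgroup_def just_infinite_def)
      have "Q \<lhd> G\<lparr>carrier := M\<rparr>"
        unfolding normal_in_subgroup_iff[OF M'(1)]
      proof (intro conjI ballI)
        fix m q assume m: "m \<in> M" and q: "q \<in> Q"
        show "m \<otimes> q \<otimes> inv m \<in> Q"
          using m q M'(1) centralizer_conj_closed[OF S _ _ Sinv[OF m], of q]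
            subgroup.mem_carrier[OF M'(1) m]
          by (auto simp: Q_def subgroup.m_closed subgroup.m_inv_closed)
      qed (use sQ in \<open>auto simp: Q_def\<close>)
      \<comment> \<open>An element outside \<open>M\<close> is outside the normalizer
        \<open>N\<close>, so \<open>dich\<close> leaves only the trivial intersection, and both
        subgroups are normal in \<open>H\<close>.\<close>
      moreover have comm: "a \<otimes> b = b \<otimes> a"
        if a: "a \<in> L" and g: "g \<in> carrier G" "g \<notin> M" and b: "b \<in> conjugate L g" for a b g
      proof -
        have "conjugate L g \<lhd> G\<lparr>carrier := H\<rparr>"
          by (rule normal_conjugate_in_normal[OF H'(1) L(1) g(1)])
        moreover have "L \<inter> conjugate L g = {\<one>}"
          using dich[OF g(1)] g M(2) by (auto simp: N_def)
        ultimately show ?thesis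
          using H.normal_Int_trivial_commute[OF L(1), of "conjugate L g" a b] a b by simp
      qed
      have "L \<subseteq> Q"
        using comm L'(2) HN M(2) Lc by (auto simp: Q_def S_def centralizer_def)
      then have "Q \<noteq> {\<one>}" using L(3) subgroup.one_closed[OF L'(1)] by blast
      ultimately have finQ: "finite_index Q G"
        using just_infinite_subgroupD[OF jiM M'(2) finM] clQ by blast
      obtain g where g: "g \<in> carrier G" "g \<notin> M"
        using M'(1,3) subgroup.subset by blast
      obtain y where y: "y \<in> L" "y \<noteq> \<one>"
        using L(3) subgroup.one_closed[OF L'(1)] by blast
      \<comment> \<open>A non-trivial element of a conjugate inside \<open>S\<close>. As
        \<open>Q\<close> centralizes \<open>S\<close>, it commutes with all of
        \<open>Q\<close>.\<close>
      define x where "x = inv g \<otimes> y \<otimes> g"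
      have yc: "y \<in> carrier G" using y Lc by blast
      have "g \<otimes> x \<otimes> inv g = y" using g yc by (simp add: x_def m_assoc[symmetric])
                (simp add: m_assoc)
      then have "x \<in> conjugate L g" "x \<noteq> \<one>"
        using y g yc by (auto simp: conjugate_def x_def)
      then have "x \<in> centralizer Q"
        using g S by (auto simp: Q_def centralizer_def S_def)
      then have "virtually_abelian G T"
        using just_infinite_virtually_abelianI[OF ji _ finQ _ \<open>x \<noteq> \<one>\<close>] sQ clQ
        by (auto simp: closed_subgroup_def)
      then show ?thesis using nva by blast
    qed
  qed
qed

end

theorem theorem1:
  fixes G :: "('a, 'b) monoid_scheme" and T :: "'a topology"
  assumes "topological_group G T"
    and "just_infinite G T"
    and "\<not> virtually_abelian G T"
  shows "(\<forall>H. closed_normal H G T \<and> H \<noteq> {\<one>\<^bsub>G\<^esub>} \<longrightarrow>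
            (just_infinite_subgroup H G T \<longleftrightarrow>
              (\<forall>M. maximal_subgroup M G T \<and> H \<subseteq> M \<longrightarrow> just_infinite_subgroup M G T))) \<and>
         (hereditarily_just_infinite G T \<longleftrightarrow>
            (\<forall>M. maximal_subgroup M G T \<and> finite_index M G \<longrightarrow> just_infinite_subgroup M G T))"
proof -
  interpret topological_group G T by fact
  note ji = assms(2) and nva = assms(3)
  have fin: "finite_index N G" if "closed_normal N G T" "N \<noteq> {\<one>\<^bsub>G\<^esub>}" for N
    using ji that by (auto simp: just_infinite_def)
  have equiv: "just_infinite_subgroup H G T \<longleftrightarrow>
      (\<forall>M. maximal_subgroup M G T \<and> H \<subseteq> M \<longrightarrow> just_infinite_subgroup M G T)"
    if H: "closed_normal H G T" "H \<noteq> {\<one>\<^bsub>G\<^esub>}" for H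
  proof
    assume jiH: "just_infinite_subgroup H G T"
    show "\<forall>M. maximal_subgroup M G T \<and> H \<subseteq> M \<longrightarrow> just_infinite_subgroup M G T"
      using just_infinite_supergroup[OF ji nva H(1) fin[OF H] jiH]
      by (simp add: maximal_subgroup_def closed_subgroup_def)
  next
    assume "\<forall>M. maximal_subgroup M G T \<and> H \<subseteq> M \<longrightarrow> just_infinite_subgroup M G T"
    then show "just_infinite_subgroup H G T"
      by (intro just_infinite_normal_subgroup[OF ji nva H(1) fin[OF H]]) simp
  qed
  have hered: "just_infinite_subgroup H G T"
    if max: "\<forall>M. maximal_subgroup M G T \<and> finite_index M G \<longrightarrow> just_infinite_subgroup M G T"
      and H: "closed_subgroup H G T" "finite_index H G" for H
  proof -
    have sH: "subgroup H G" "closedin T H" using H by (auto simp: closed_subgroup_def)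
    \<comment> \<open>\<open>H\<close> need not be normal, so the argument descends to its core and
      then climbs back to \<open>H\<close>. Maximal subgroups above the core have finite index, so
      \<open>max\<close> applies to them.\<close>
    have N: "closed_normal (core H) G T" "finite_index (core H) G" "subgroup (core H) G"
      using core_normal[OF sH(1)] normal_imp_subgroup closedin_core[OF sH(2)]
        finite_index_core[OF sH(1) H(2)] by (auto simp: closed_normal_def)
    have "just_infinite_subgroup (core H) G T"
    proof (rule just_infinite_normal_subgroup[OF ji nva N(1,2)])
      fix M assume M: "maximal_subgroup M G T" "core H \<subseteq> M"
      then have "finite_index M G"
        using finite_index_mono[OF N(3) _ M(2) N(2)] by (auto simp: maximal_subgroup_def closed_subgroup_def)
      then show "just_infinite_subgroup M G T" using max M by blast
    qed
    then show ?thesis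
      using just_infinite_supergroup[OF ji nva N(1,2) _ sH(1)] core_subset[OF subgroup.subset[OF sH(1)]]
      by blast
  qed
  have max: "just_infinite_subgroup M G T"
    if "hereditarily_just_infinite G T" "maximal_subgroup M G T" "finite_index M G" for M
    using that by (simp add: hereditarily_just_infinite_def maximal_subgroup_def)
  show ?thesis
  proof (intro conjI allI impI iffI)
    assume "\<forall>M. maximal_subgroup M G T \<and> finite_index M G \<longrightarrow> just_infinite_subgroup M G T"
    then show "hereditarily_just_infinite G T"
      using hered unfolding hereditarily_just_infinite_def by simp
  qed (use equiv max in simp_all)
qed

end
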